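(* Let $\Gamma$ be a finitely generated metabelian group which is not polycyclic. Then $d^{+}_{\Gamma}\leq 3$.
   Context: Two elements of a group are positively independent if they freely generate a free semigroup. For a finitely generated group $\Gamma$, let $\mathcal{C}$ be the set of all finite generating subsets $\Sigma$ of $\Gamma$ that are symmetric ($s\in\Sigma\Rightarrow s^{-1}\in\Sigma$) and contain the identity. For $\Sigma\in\mathcal{C}$, $\Sigma^n$ denotes the set of all products of at most $n$ elements of $\Sigma$. Define $d^{+}(\Sigma)=\inf\{n\in\mathbb{N} : \Sigma^n \text{ contains two positively independent elements}\}$ (equal to $+\infty$ if there is no such $n$), and $d^{+}_{\Gamma}=\sup\{d^{+}(\Sigma) : \Sigma\in\mathcal{C}\}$. A group is metabelian if it is an extension of an abelian group by an abelian group. *)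

theory Defs
  imports "HOL-Algebra.Algebra" "HOL-Library.Extended_Nat"
begin

definition word_prod :: "('a, 'b) monoid_scheme \<Rightarrow> 'a list \<Rightarrow> 'a" where
  "word_prod G w = foldr (\<otimes>\<^bsub>G\<^esub>) w \<one>\<^bsub>G\<^esub>"

(* The free semigroup on two generators is the set of nonempty words over bool.  Injectivity of
   the induced homomorphism also forces a and b to be distinct (one-letter words). *)
definition positively_independent :: "('a, 'b) monoid_scheme \<Rightarrow> 'a \<Rightarrow> 'a \<Rightarrow> bool" where
  "positively_independent G a b \<longleftrightarrow>
     a \<in> carrier G \<and> b \<in> carrier G \<and>
     inj_on (\<lambda>w :: bool list. word_prod G (map (\<lambda>x. if x then a else b) w)) {w. w \<noteq> []}"

definition finitely_generated_group :: "('a, 'b) monoid_scheme \<Rightarrow> bool" where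
  "finitely_generated_group G \<longleftrightarrow>
     group G \<and> (\<exists>S. finite S \<and> S \<subseteq> carrier G \<and> generate G S = carrier G)"

definition sym_generating_sets :: "('a, 'b) monoid_scheme \<Rightarrow> 'a set set" where
  "sym_generating_sets G =
     {S. finite S \<and> S \<subseteq> carrier G \<and> generate G S = carrier G \<and>
         (\<forall>s\<in>S. inv\<^bsub>G\<^esub> s \<in> S) \<and> \<one>\<^bsub>G\<^esub> \<in> S}"

definition set_power :: "('a, 'b) monoid_scheme \<Rightarrow> 'a set \<Rightarrow> nat \<Rightarrow> 'a set" where
  "set_power G S n = {word_prod G w | w. set w \<subseteq> S \<and> length w \<le> n}"

(* In enat the infimum of the empty set is infinity. *)
definition d_plus :: "('a, 'b) monoid_scheme \<Rightarrow> 'a set \<Rightarrow> enat" where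
  "d_plus G S =
     Inf {enat n | n. \<exists>a\<in>set_power G S n. \<exists>b\<in>set_power G S n. positively_independent G a b}"

definition d_plus_group :: "('a, 'b) monoid_scheme \<Rightarrow> enat" where
  "d_plus_group G = (SUP S\<in>sym_generating_sets G. d_plus G S)"

definition metabelian :: "('a, 'b) monoid_scheme \<Rightarrow> bool" where
  "metabelian G \<longleftrightarrow>
     group G \<and> (\<exists>N. N \<lhd> G \<and> comm_group (G\<lparr>carrier := N\<rparr>) \<and> comm_group (G Mod N))"

(* Subgroups admitting a finite subnormal series with cyclic factors; same pattern as
   solvable_seq in HOL-Algebra.Solvable_Groups. *)
inductive polycyclic_seq :: "('a, 'b) monoid_scheme \<Rightarrow> 'a set \<Rightarrow> bool"
  for G where
    unity: "polycyclic_seq G {\<one>\<^bsub>G\<^esub>}"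
  | extension: "\<lbrakk> polycyclic_seq G K; K \<lhd> (G\<lparr>carrier := H\<rparr>); subgroup H G;
                  cyclic_group ((G\<lparr>carrier := H\<rparr>) Mod K) \<rbrakk> \<Longrightarrow> polycyclic_seq G H"

definition polycyclic :: "('a, 'b) monoid_scheme \<Rightarrow> bool" where
  "polycyclic G \<longleftrightarrow> group G \<and> polycyclic_seq G (carrier G)"

end

theory Submission
  imports Defs
begin

text \<open>
  Let \<open>\<Sigma>\<close> be a generating set containing the identity, and \<open>N\<close> an abelian normal subgroup with
  abelian quotient.  For \<open>x, y, z \<in> \<Sigma>\<close> the two words \<open>xyz\<close> and \<open>yxz\<close> of length three differ by the
  commutator \<open>m = [x,y]\<close>: with \<open>b = yxz\<close> they are \<open>mb\<close> and \<open>b\<close>.  The proof shows that if none of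
  these pairs is positively independent, then the group is polycyclic.

  A word of length \<open>n\<close> in \<open>mb\<close> and \<open>b\<close> equals \<open>c b\<^sup>n\<close>, where \<open>c\<close> is the ordered product of some of
  the conjugates \<open>m\<^sub>i = b\<^sup>i m b\<^sup>-\<^sup>i\<close>, \<open>0 \<le> i < n\<close>.  A coincidence between two different words can be
  brought to words of equal length with different first and different last letters.  Over the
  group ring it says that a polynomial in \<open>b\<close> with coefficients in \<open>{-1,0,1}\<close> kills \<open>m\<close>, and the
  first and last letters make its constant and leading coefficients units.  Hence finitely many
  of the \<open>m\<^sub>i\<close> generate a subgroup that is stable under conjugation by \<open>b\<close> and by its inverse
  (\<open>dependent_pair_finite_span\<close>).

  Conjugations commute with each other on \<open>N\<close>, so such finite sets of conjugators can be multiplied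
  together for several elements \<open>b\<close> (\<open>conj_invariant_combine\<close>).  The elements \<open>yxz\<close>, \<open>z \<in> \<Sigma>\<close>,
  generate the whole group, because \<open>z = (yx\<one>)\<^sup>-\<^sup>1 (yxz)\<close>; hence the normal closure of \<open>[x,y]\<close> is
  finitely generated.  The product \<open>K\<close> of these closures over \<open>x, y \<in> \<Sigma>\<close> is a finitely generated
  subgroup of \<open>N\<close> containing all commutators.  So \<open>K\<close> and the quotient by \<open>K\<close> are finitely generated
  abelian, and adding generators one at a time gives a subnormal series with cyclic factors
  (\<open>polycyclic_seq_generate\<close>).
\<close>

section \<open>Conjugates and commutators\<close>

definition conjugate :: "('a, 'b) monoid_scheme \<Rightarrow> 'a \<Rightarrow> 'a \<Rightarrow> 'a" where
  "conjugate G g x = g \<otimes>\<^bsub>G\<^esub> x \<otimes>\<^bsub>G\<^esub> inv\<^bsub>G\<^esub> g"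

definition commutator :: "('a, 'b) monoid_scheme \<Rightarrow> 'a \<Rightarrow> 'a \<Rightarrow> 'a" where
  "commutator G x y = x \<otimes>\<^bsub>G\<^esub> y \<otimes>\<^bsub>G\<^esub> inv\<^bsub>G\<^esub> (y \<otimes>\<^bsub>G\<^esub> x)"

text \<open>
  When \<open>m\<close> lies in an abelian normal subgroup, this is the additive subgroup spanned by the
  translates \<open>e \<cdot> m\<close> in that module over the group ring.  Keeping the conjugators \<open>E\<close>, rather than
  the conjugates, as the parameter is what allows two such spans to be combined by multiplying
  their sets of conjugators.
\<close>
definition conj_span :: "('a, 'b) monoid_scheme \<Rightarrow> 'a \<Rightarrow> 'a set \<Rightarrow> 'a set" where
  "conj_span G m E = generate G ((\<lambda>e. conjugate G e m) ` E)"

definition conj_invariant :: "('a, 'b) monoid_scheme \<Rightarrow> 'a \<Rightarrow> 'a set \<Rightarrow> 'a \<Rightarrow> bool" where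
  "conj_invariant G m E t \<longleftrightarrow>
     (\<forall>h \<in> conj_span G m E.
        conjugate G t h \<in> conj_span G m E \<and> conjugate G (inv\<^bsub>G\<^esub> t) h \<in> conj_span G m E)"

abbreviation word_value :: "('a, 'b) monoid_scheme \<Rightarrow> 'a \<Rightarrow> 'a \<Rightarrow> bool list \<Rightarrow> 'a" where
  "word_value G a b w \<equiv> word_prod G (map (\<lambda>x. if x then a else b) w)"

context group
begin

lemma conjugate_closed [simp]:
  "\<lbrakk>g \<in> carrier G; x \<in> carrier G\<rbrakk> \<Longrightarrow> conjugate G g x \<in> carrier G"
  by (simp add: conjugate_def)

lemma commutator_closed [simp]:
  "\<lbrakk>x \<in> carrier G; y \<in> carrier G\<rbrakk> \<Longrightarrow> commutator G x y \<in> carrier G"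
  by (simp add: commutator_def)

lemma inv_cancel:
  assumes "x \<in> carrier G" "y \<in> carrier G"
  shows "x \<otimes> (inv x \<otimes> y) = y" "inv x \<otimes> (x \<otimes> y) = y"
  using assms by (simp_all flip: m_assoc)

lemma conjugate_mult:
  assumes "g \<in> carrier G" "x \<in> carrier G" "y \<in> carrier G"
  shows "conjugate G g (x \<otimes> y) = conjugate G g x \<otimes> conjugate G g y"
  using assms by (simp add: conjugate_def m_assoc inv_solve_left)

lemma conjugate_one [simp]: "g \<in> carrier G \<Longrightarrow> conjugate G g \<one> = \<one>"
  by (simp add: conjugate_def)

lemma conjugate_id [simp]: "x \<in> carrier G \<Longrightarrow> conjugate G \<one> x = x"
  by (simp add: conjugate_def)

lemma conjugate_inv:
  assumes "g \<in> carrier G" "x \<in> carrier G"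
  shows "conjugate G g (inv x) = inv (conjugate G g x)"
  using assms by (simp add: conjugate_def m_assoc inv_mult_group)

lemma conjugate_conjugate:
  assumes "g \<in> carrier G" "h \<in> carrier G" "x \<in> carrier G"
  shows "conjugate G g (conjugate G h x) = conjugate G (g \<otimes> h) x"
  using assms by (simp add: conjugate_def m_assoc inv_mult_group)

lemma commutator_mult:
  assumes "x \<in> carrier G" "y \<in> carrier G"
  shows "commutator G x y \<otimes> (y \<otimes> x) = x \<otimes> y"
  using assms by (simp add: commutator_def m_assoc)

lemma conjugate_generate:
  assumes H: "subgroup H G" and g: "g \<in> carrier G" and S: "S \<subseteq> carrier G"
    and gen: "\<And>s. s \<in> S \<Longrightarrow> conjugate G g s \<in> H"
    and x: "x \<in> generate G S"
  shows "conjugate G g x \<in> H"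
  using x
proof (induction rule: generate.induct)
  case one
  then show ?case using H g by (simp add: subgroup.one_closed)
next
  case (incl h)
  then show ?case by (rule gen)
next
  case (inv h)
  then show ?case
    using gen[of h] g S H by (simp add: conjugate_inv subset_iff subgroup.m_inv_closed)
next
  case (eng h1 h2)
  then show ?case
    using g H S generate_in_carrier by (simp add: conjugate_mult subgroup.m_closed)
qed

lemma conj_span_subgroup:
  assumes "m \<in> carrier G" "E \<subseteq> carrier G"
  shows "subgroup (conj_span G m E) G"
  unfolding conj_span_def by (rule generate_is_subgroup) (use assms in auto)

lemma conj_span_incl: "e \<in> E \<Longrightarrow> conjugate G e m \<in> conj_span G m E"
  unfolding conj_span_def by (rule generate.incl) simp

lemma conj_span_mono: "E \<subseteq> F \<Longrightarrow> conj_span G m E \<subseteq> conj_span G m F"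
  unfolding conj_span_def by (intro mono_generate image_mono)

text \<open>Conjugation by \<open>g\<close> turns the spanning conjugators \<open>E\<close> into \<open>gE\<close>, so inclusions between
  conjugated spans only have to be tested on conjugators.\<close>
lemma conjugate_conj_span:
  assumes "m \<in> carrier G" "E \<subseteq> carrier G" "F \<subseteq> carrier G" "g \<in> carrier G"
    and "\<And>e. e \<in> E \<Longrightarrow> conjugate G (g \<otimes> e) m \<in> conj_span G m F"
    and "x \<in> conj_span G m E"
  shows "conjugate G g x \<in> conj_span G m F"
  by (rule conjugate_generate[OF conj_span_subgroup[OF assms(1,3)] assms(4) _ _
        assms(6)[unfolded conj_span_def]])
     (use assms(1,2,4,5) in \<open>auto simp: conjugate_conjugate subset_iff\<close>)

lemma conj_invariantI:
  assumes "m \<in> carrier G" "E \<subseteq> carrier G" "t \<in> carrier G"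
    and "\<And>e. e \<in> E \<Longrightarrow> conjugate G (t \<otimes> e) m \<in> conj_span G m E"
    and "\<And>e. e \<in> E \<Longrightarrow> conjugate G (inv t \<otimes> e) m \<in> conj_span G m E"
  shows "conj_invariant G m E t"
  unfolding conj_invariant_def using assms by (auto intro: conjugate_conj_span)

section \<open>Relations between elements that are not positively independent\<close>

lemma word_prod_Nil [simp]: "word_prod G [] = \<one>"
  by (simp add: word_prod_def)

lemma word_prod_Cons [simp]: "word_prod G (x # w) = x \<otimes> word_prod G w"
  by (simp add: word_prod_def)

lemma word_prod_closed: "set w \<subseteq> carrier G \<Longrightarrow> word_prod G w \<in> carrier G"
  by (induction w) auto

lemma word_prod_append:
  "\<lbrakk>set u \<subseteq> carrier G; set v \<subseteq> carrier G\<rbrakk>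
    \<Longrightarrow> word_prod G (u @ v) = word_prod G u \<otimes> word_prod G v"
  using word_prod_closed[of v] word_prod_closed
  by (induction u) (auto simp: m_assoc)

lemma word_value_closed [simp]:
  "\<lbrakk>a \<in> carrier G; b \<in> carrier G\<rbrakk> \<Longrightarrow> word_value G a b w \<in> carrier G"
  by (rule word_prod_closed) auto

lemma word_value_append:
  "\<lbrakk>a \<in> carrier G; b \<in> carrier G\<rbrakk>
    \<Longrightarrow> word_value G a b (u @ v) = word_value G a b u \<otimes> word_value G a b v"
  by (simp, rule word_prod_append) auto

text \<open>
  If \<open>u\<close> and \<open>v\<close> have the same value, then so do \<open>u x v\<close> and \<open>v x u\<close>, which have the same length.
  The letter \<open>x\<close> in the middle can be chosen to make them different as words; \<open>uv\<close> and \<open>vu\<close> would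
  not do when \<open>u\<close> and \<open>v\<close> are powers of a common word.
\<close>
lemma equal_length_relation:
  assumes ab: "a \<in> carrier G" "b \<in> carrier G" and dep: "\<not> positively_independent G a b"
  obtains u v where "u \<noteq> v" "length u = length v" "word_value G a b u = word_value G a b v"
proof -
  note app = word_value_append[OF ab]
  from dep ab obtain u v where uv: "u \<noteq> v" "word_value G a b u = word_value G a b v"
    unfolding positively_independent_def inj_on_def by blast
  show thesis
  proof (cases "\<exists>x. u @ x # v \<noteq> v @ x # u")
    case True
    then obtain x where x: "u @ (x # v) \<noteq> v @ (x # u)" by blast
    have "word_value G a b (u @ (x # v)) = word_value G a b (v @ (x # u))"
      using uv(2) by (simp add: app del: map_append)
    then show thesis using that[OF x] by simp
  next
    case False
    \<comment> \<open>If \<open>p\<close> is shorter than \<open>q\<close>, the letter of \<open>p x q\<close> in position \<open>length p\<close> is \<open>x\<close>, while that of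
      \<open>q x p\<close> is a fixed letter of \<open>q\<close>.\<close>
    have "length u = length v"
    proof (rule ccontr)
      assume neq: "length u \<noteq> length v"
      have *: False if "length p < length q" "\<forall>x. p @ x # q = q @ x # p" for p q :: "bool list"
      proof -
        have "x = q ! length p" for x
          using that(1) arg_cong[OF spec[OF that(2), of x], of "\<lambda>l. l ! length p"]
          by (simp add: nth_append)
        from this[of True] this[of False] show False by simp
      qed
      have "\<forall>x. u @ x # v = v @ x # u" "\<forall>x. v @ x # u = u @ x # v" using False by metis+
      with * neq show False by (meson linorder_neqE_nat)
    qed
    then show thesis using that uv by blast
  qed
qed

text \<open>
  In a shortest relation between two words of equal length, both the first and the last letters
  differ, since otherwise they could be cancelled.  Isolating the first letters gives \<open>u, v\<close> and
  isolating the last letters gives \<open>u', v'\<close>; as the two sides can be exchanged, the letter \<open>a\<close> may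
  be put on the left in both equations.
\<close>
lemma reduced_relation:
  assumes ab: "a \<in> carrier G" "b \<in> carrier G" and dep: "\<not> positively_independent G a b"
  obtains n u v u' v' where "length u = n" "length v = n" "length u' = n" "length v' = n"
    "a \<otimes> word_value G a b u = b \<otimes> word_value G a b v"
    "word_value G a b u' \<otimes> a = word_value G a b v' \<otimes> b"
proof -
  define R where "R n \<longleftrightarrow> (\<exists>u v. u \<noteq> v \<and> length u = n \<and> length v = n \<and>
      word_value G a b u = word_value G a b v)" for n
  obtain k where "R k"
    using equal_length_relation[OF assms] unfolding R_def by metis
  define n where "n = (LEAST n. R n)"
  have "R n" unfolding n_def by (rule LeastI[of R, OF \<open>R k\<close>])
  have least: "\<not> R j" if "j < n" for j
    using that not_less_Least unfolding n_def by blast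
  from \<open>R n\<close> obtain u v where uv: "u \<noteq> v" "length u = n" "length v = n"
    "word_value G a b u = word_value G a b v" unfolding R_def by blast
  then have "n > 0" by (cases n) auto
  then obtain p where p: "n = Suc p" by (cases n) auto
  have notR: "\<not> R p" using least p by simp
  obtain x s y t where hd: "u = x # s" "v = y # t" "length s = p" "length t = p"
    using uv p by (metis length_Suc_conv)
  obtain x' s' y' t' where last: "u = s' @ [x']" "v = t' @ [y']" "length s' = p" "length t' = p"
    using uv p by (metis length_Suc_conv_rev)
  have "x \<noteq> y"
  proof
    assume "x = y"
    with uv hd ab have "word_value G a b s = word_value G a b t" by (auto split: if_splits)
    with uv hd \<open>x = y\<close> notR show False unfolding R_def by blast
  qed
  have "x' \<noteq> y'"
  proof
    assume "x' = y'"
    with uv(4) last ab have "word_value G a b s' = word_value G a b t'"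
      by (simp add: word_value_append del: map_append split: if_splits)
    with uv last \<open>x' = y'\<close> notR show False unfolding R_def by blast
  qed
  from uv(4) hd have h: "(if x then a else b) \<otimes> word_value G a b s
      = (if y then a else b) \<otimes> word_value G a b t" by simp
  from uv(4) last ab have l: "word_value G a b s' \<otimes> (if x' then a else b)
      = word_value G a b t' \<otimes> (if y' then a else b)"
    by (simp add: word_value_append del: map_append split: if_splits)
  obtain u1 v1 where 1: "length u1 = p" "length v1 = p"
    "a \<otimes> word_value G a b u1 = b \<otimes> word_value G a b v1"
    using h \<open>x \<noteq> y\<close> that[of s t] that[of t s] hd(3,4) by (cases x; cases y) simp_all
  obtain u2 v2 where 2: "length u2 = p" "length v2 = p"
    "word_value G a b u2 \<otimes> a = word_value G a b v2 \<otimes> b"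
    using l \<open>x' \<noteq> y'\<close> that[of s' t'] that[of t' s'] last(3,4) by (cases x'; cases y') simp_all
  show thesis by (rule that[OF 1(1,2) 2(1,2) 1(3) 2(3)])
qed

text \<open>
  Moving all letters \<open>b\<close> to the right turns each factor \<open>m\<close> into a conjugate of \<open>m\<close> by the power of
  \<open>b\<close> that it has passed.
\<close>
lemma word_value_normal_form:
  assumes mb: "m \<in> carrier G" "b \<in> carrier G"
  shows "\<exists>c \<in> conj_span G m ((\<lambda>i. b [^] i) ` {..<length w}).
           word_value G (m \<otimes> b) b w = c \<otimes> b [^] length w"
proof (induction w)
  case Nil
  show ?case by (auto simp: conj_span_def intro: bexI[OF _ generate.one])
next
  case (Cons x w)
  define E where "E n = (\<lambda>i. b [^] i) ` {..<n}" for n :: nat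
  have E: "E n \<subseteq> carrier G" for n unfolding E_def using mb by auto
  note sub = conj_span_subgroup[OF mb(1) E]
  from Cons obtain c where c: "c \<in> conj_span G m (E (length w))"
    "word_value G (m \<otimes> b) b w = c \<otimes> b [^] length w"
    unfolding E_def by blast
  have cc: "c \<in> carrier G" using subgroup.mem_carrier[OF sub c(1)] .
  have "conjugate G (b \<otimes> e) m \<in> conj_span G m (E (Suc (length w)))" if "e \<in> E (length w)" for e
  proof -
    from that obtain i where "i < length w" "e = b [^] i" unfolding E_def by blast
    then have "b \<otimes> e = b [^] Suc i" using mb nat_pow_Suc2 by simp
    with \<open>i < length w\<close> have "b \<otimes> e \<in> E (Suc (length w))" unfolding E_def by blast
    then show ?thesis by (rule conj_span_incl)
  qed
  then have d: "conjugate G b c \<in> conj_span G m (E (Suc (length w)))"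
    using conjugate_conj_span[OF mb(1) E E mb(2)] c(1) by blast
  have "m = conjugate G (b [^] (0::nat)) m" using mb by simp
  then have m: "m \<in> conj_span G m (E (Suc (length w)))"
    unfolding E_def using conj_span_incl by (metis image_eqI lessThan_iff zero_less_Suc)
  have bc: "b \<otimes> (c \<otimes> b [^] length w) = conjugate G b c \<otimes> b [^] Suc (length w)"
    using mb cc nat_pow_Suc2[OF mb(2), of "length w"]
    by (simp add: conjugate_def m_assoc inv_solve_left del: nat_pow_Suc)
  have "word_value G (m \<otimes> b) b (x # w)
      = (if x then m \<otimes> conjugate G b c else conjugate G b c) \<otimes> b [^] length (x # w)"
    using bc mb cc c(2) by (simp add: m_assoc del: nat_pow_Suc)
  moreover have "(if x then m \<otimes> conjugate G b c else conjugate G b c)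
      \<in> conj_span G m (E (Suc (length w)))"
    using d m sub by (simp add: subgroup.m_closed)
  ultimately show ?case unfolding E_def by auto
qed

text \<open>
  Write \<open>m\<^sub>i\<close> for the conjugate of \<open>m\<close> by \<open>b\<^sup>i\<close>.  In normal form, a relation whose words of length
  \<open>n + 1\<close> have different last letters expresses \<open>m\<^sub>n\<close> through \<open>m\<^sub>0, \<dots>, m\<^sub>n\<^sub>-\<^sub>1\<close>, and one with different
  first letters expresses \<open>m\<^sub>0\<close> through \<open>m\<^sub>1, \<dots>, m\<^sub>n\<close>, that is, \<open>m\<^sub>-\<^sub>1\<close> through
  \<open>m\<^sub>0, \<dots>, m\<^sub>n\<^sub>-\<^sub>1\<close>.  The conjugators \<open>b\<^sup>0, \<dots>, b\<^sup>n\<close> therefore span a subgroup stable under \<open>b\<close> in both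
  directions.  The last one, \<open>b\<^sup>n\<close>, is included so that \<open>\<one>\<close> is present even when \<open>n = 0\<close>.
\<close>
lemma dependent_pair_finite_span:
  assumes mb: "m \<in> carrier G" "b \<in> carrier G"
    and dep: "\<not> positively_independent G (m \<otimes> b) b"
  obtains E where "finite E" "E \<subseteq> carrier G" "\<one> \<in> E" "conj_invariant G m E b"
proof -
  have ab: "m \<otimes> b \<in> carrier G" "b \<in> carrier G" using mb by auto
  obtain n u v u' v' where len: "length u = n" "length v = n" "length u' = n" "length v' = n"
    and first: "m \<otimes> b \<otimes> word_value G (m \<otimes> b) b u = b \<otimes> word_value G (m \<otimes> b) b v"
    and last: "word_value G (m \<otimes> b) b u' \<otimes> (m \<otimes> b) = word_value G (m \<otimes> b) b v' \<otimes> b"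
    by (rule reduced_relation[OF ab dep]) (rule that)
  define E where "E k = (\<lambda>i. b [^] i) ` {..<k}" for k :: nat
  have E: "E k \<subseteq> carrier G" for k unfolding E_def using mb by auto
  note sub = conj_span_subgroup[OF mb(1) E]
  note nf = word_value_normal_form[OF mb, folded E_def]
  obtain c where c: "c \<in> conj_span G m (E n)" "word_value G (m \<otimes> b) b u = c \<otimes> b [^] n"
    using nf[of u] len by auto
  obtain d where d: "d \<in> conj_span G m (E n)" "word_value G (m \<otimes> b) b v = d \<otimes> b [^] n"
    using nf[of v] len by auto
  obtain c' where c': "c' \<in> conj_span G m (E n)" "word_value G (m \<otimes> b) b u' = c' \<otimes> b [^] n"
    using nf[of u'] len by auto
  obtain d' where d': "d' \<in> conj_span G m (E n)" "word_value G (m \<otimes> b) b v' = d' \<otimes> b [^] n"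
    using nf[of v'] len by auto
  have car: "c \<in> carrier G" "d \<in> carrier G" "c' \<in> carrier G" "d' \<in> carrier G"
    using subgroup.mem_carrier[OF sub c(1)] subgroup.mem_carrier[OF sub d(1)]
      subgroup.mem_carrier[OF sub c'(1)] subgroup.mem_carrier[OF sub d'(1)] by auto
  have incl: "conj_span G m (E n) \<subseteq> conj_span G m (E (Suc n))"
    by (rule conj_span_mono) (auto simp: E_def)
  have "(m \<otimes> b \<otimes> c) \<otimes> b [^] n = (b \<otimes> d) \<otimes> b [^] n"
    using first c(2) d(2) car mb by (simp add: m_assoc)
  then have "m \<otimes> b \<otimes> c = b \<otimes> d" using car mb by simp
  then have "m = b \<otimes> d \<otimes> inv c \<otimes> inv b"
    using car mb inv_solve_right' by (metis inv_closed m_closed)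
  then have "conjugate G (inv b) m = d \<otimes> inv c"
    using car mb by (simp add: conjugate_def m_assoc inv_solve_left')
  then have low: "conjugate G (inv b) m \<in> conj_span G m (E (Suc n))"
    using c(1) d(1) sub incl by (auto simp: subgroup.m_closed subgroup.m_inv_closed)
  have "(c' \<otimes> b [^] n \<otimes> m) \<otimes> b = (d' \<otimes> b [^] n) \<otimes> b"
    using last c'(2) d'(2) car mb by (simp add: m_assoc)
  then have "c' \<otimes> b [^] n \<otimes> m = d' \<otimes> b [^] n" using car mb by simp
  then have "d' = c' \<otimes> b [^] n \<otimes> m \<otimes> inv (b [^] n)"
    using car mb by (simp add: inv_solve_right)
  then have "conjugate G (b [^] n) m = inv c' \<otimes> d'"
    using car mb by (simp add: conjugate_def m_assoc inv_cancel)
  then have "conjugate G (b [^] n) m \<in> conj_span G m (E n)"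
    using c'(1) d'(1) sub by (auto simp: subgroup.m_closed subgroup.m_inv_closed)
  moreover have step: "b \<otimes> b [^] i = b [^] Suc i" for i :: nat
    using mb nat_pow_Suc2 by simp
  have up: "conjugate G (b \<otimes> e) m \<in> conj_span G m (E (Suc n))" if "e \<in> E n" for e
  proof -
    from that obtain i where "i < n" "e = b [^] i" unfolding E_def by blast
    then have "b \<otimes> e \<in> E (Suc n)"
      unfolding E_def using step[of i] by (intro image_eqI[of _ _ "Suc i"]) auto
    then show ?thesis by (rule conj_span_incl)
  qed
  ultimately have "conjugate G b (conjugate G (b [^] n) m) \<in> conj_span G m (E (Suc n))"
    using conjugate_conj_span[OF mb(1) E E mb(2)] by blast
  then have top: "conjugate G (b \<otimes> b [^] n) m \<in> conj_span G m (E (Suc n))"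
    using mb by (simp add: conjugate_conjugate)
  have "conj_invariant G m (E (Suc n)) b"
  proof (rule conj_invariantI[OF mb(1) E mb(2)])
    fix e assume "e \<in> E (Suc n)"
    then obtain i where i: "i < Suc n" "e = b [^] i" unfolding E_def by blast
    show "conjugate G (b \<otimes> e) m \<in> conj_span G m (E (Suc n))"
      using i top up by (cases "i = n") (auto simp: E_def)
    show "conjugate G (inv b \<otimes> e) m \<in> conj_span G m (E (Suc n))"
    proof (cases i)
      case 0
      then show ?thesis using i low mb by simp
    next
      case (Suc j)
      then have "inv b \<otimes> e = b [^] j"
        using i mb step[of j] by (metis inv_solve_left' nat_pow_closed)
      then have "inv b \<otimes> e \<in> E (Suc n)" unfolding E_def using i Suc by auto
      then show ?thesis by (rule conj_span_incl)
    qed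
  qed
  moreover have "\<one> \<in> E (Suc n)" unfolding E_def by (rule image_eqI[of _ _ 0]) auto
  ultimately show thesis using that[of "E (Suc n)"] E by (simp add: E_def)
qed

section \<open>Finitely generated normal closures\<close>

text \<open>
  This plays the role of the fact that finitely many commuting integral elements generate a finite
  algebra: if \<open>A\<close> works for \<open>s\<close>, then so does \<open>AB\<close> for every \<open>B\<close>, because on \<open>m\<close> the
  conjugations by \<open>B\<close> can be carried out after those by \<open>A\<close> and by \<open>s\<close>.
\<close>
lemma conj_invariant_combine:
  assumes m: "m \<in> carrier G"
    and comm: "\<And>g h. \<lbrakk>g \<in> carrier G; h \<in> carrier G\<rbrakk>
      \<Longrightarrow> conjugate G (g \<otimes> h) m = conjugate G (h \<otimes> g) m"
    and T: "finite T" "T \<subseteq> carrier G"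
    and single: "\<And>t. t \<in> T \<Longrightarrow>
      \<exists>E. finite E \<and> E \<subseteq> carrier G \<and> \<one> \<in> E \<and> conj_invariant G m E t"
  shows "\<exists>E. finite E \<and> E \<subseteq> carrier G \<and> \<one> \<in> E \<and> (\<forall>t\<in>T. conj_invariant G m E t)"
  using T single
proof (induction T rule: finite_induct)
  case empty
  show ?case by (rule exI[of _ "{\<one>}"]) auto
next
  case (insert t T)
  then obtain E1 where E1: "finite E1" "E1 \<subseteq> carrier G" "\<one> \<in> E1"
    "\<forall>t\<in>T. conj_invariant G m E1 t" by auto
  obtain E2 where E2: "finite E2" "E2 \<subseteq> carrier G" "\<one> \<in> E2" "conj_invariant G m E2 t"
    using insert.prems(2) by blast
  have prod_inv: "conj_invariant G m (A <#> B) s"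
    if A: "A \<subseteq> carrier G" and B: "B \<subseteq> carrier G" and s: "s \<in> carrier G"
      and inv: "conj_invariant G m A s" for A B s
  proof -
    have AB: "A <#> B \<subseteq> carrier G" using A B by (rule set_mult_closed)
    have key: "conjugate G (g \<otimes> (a \<otimes> b)) m \<in> conj_span G m (A <#> B)"
      if "a \<in> A" "b \<in> B" "g \<in> carrier G"
        and g: "conjugate G g (conjugate G a m) \<in> conj_span G m A" for a b g
    proof -
      have ab: "a \<in> carrier G" "b \<in> carrier G" using that A B by auto
      have "conjugate G (g \<otimes> (a \<otimes> b)) m = conjugate G ((g \<otimes> a) \<otimes> b) m"
        using ab that by (simp add: m_assoc)
      also have "\<dots> = conjugate G (b \<otimes> (g \<otimes> a)) m" using ab that comm by simp
      also have "\<dots> = conjugate G b (conjugate G g (conjugate G a m))"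
        using ab that m by (simp add: conjugate_conjugate)
      finally have eq: "conjugate G (g \<otimes> (a \<otimes> b)) m
        = conjugate G b (conjugate G g (conjugate G a m))" .
      have "conjugate G (b \<otimes> e) m \<in> conj_span G m (A <#> B)" if "e \<in> A" for e
      proof -
        have "conjugate G (b \<otimes> e) m = conjugate G (e \<otimes> b) m"
          using comm ab that A by blast
        moreover have "e \<otimes> b \<in> A <#> B" using that \<open>b \<in> B\<close> by (auto simp: set_mult_def)
        ultimately show ?thesis by (simp add: conj_span_incl)
      qed
      then show ?thesis unfolding eq by (rule conjugate_conj_span[OF m A AB ab(2) _ g])
    qed
    show ?thesis
    proof (rule conj_invariantI[OF m AB s])
      fix e assume "e \<in> A <#> B"
      then obtain a b where e: "a \<in> A" "b \<in> B" "e = a \<otimes> b" by (auto simp: set_mult_def)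
      have "conjugate G a m \<in> conj_span G m A" using e by (rule_tac conj_span_incl)
      then have "conjugate G s (conjugate G a m) \<in> conj_span G m A"
        "conjugate G (inv s) (conjugate G a m) \<in> conj_span G m A"
        using inv unfolding conj_invariant_def by auto
      then show "conjugate G (s \<otimes> e) m \<in> conj_span G m (A <#> B)"
        "conjugate G (inv s \<otimes> e) m \<in> conj_span G m (A <#> B)"
        using key e s by simp_all
    qed
  qed
  have swap: "conj_span G m (E1 <#> E2) = conj_span G m (E2 <#> E1)"
  proof -
    have "(\<lambda>e. conjugate G e m) ` (A <#> B) \<subseteq> (\<lambda>e. conjugate G e m) ` (B <#> A)"
      if "A \<subseteq> carrier G" "B \<subseteq> carrier G" for A B
    proof clarify
      fix e assume "e \<in> A <#> B"
      then obtain a b where "a \<in> A" "b \<in> B" "e = a \<otimes> b" by (auto simp: set_mult_def)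
      moreover from this that have "conjugate G e m = conjugate G (b \<otimes> a) m"
        using comm by blast
      ultimately show "conjugate G e m \<in> (\<lambda>e. conjugate G e m) ` (B <#> A)"
        by (auto simp: set_mult_def)
    qed
    from this[OF E1(2) E2(2)] this[OF E2(2) E1(2)] show ?thesis
      unfolding conj_span_def by (simp add: subset_antisym)
  qed
  have "conj_invariant G m (E1 <#> E2) t"
    using prod_inv[OF E2(2) E1(2) _ E2(4)] insert.prems(1) swap by (simp add: conj_invariant_def)
  moreover have "\<forall>s\<in>T. conj_invariant G m (E1 <#> E2) s"
    using prod_inv[OF E1(2) E2(2)] E1(4) insert.prems(1) by blast
  moreover have "\<one> \<in> E1 <#> E2" unfolding set_mult_def using E1(3) E2(3) by force
  moreover have "finite (E1 <#> E2)" using E1(1) E2(1) by (simp add: set_mult_def)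
  ultimately show ?case using set_mult_closed[OF E1(2) E2(2)]
    by (intro exI[of _ "E1 <#> E2"]) simp
qed

lemma conj_span_normal:
  assumes m: "m \<in> carrier G" and E: "E \<subseteq> carrier G" and T: "T \<subseteq> carrier G"
    and gen: "generate G T = carrier G" and inv: "\<forall>t\<in>T. conj_invariant G m E t"
  shows "conj_span G m E \<lhd> G"
proof (rule normal_invI)
  show sub: "subgroup (conj_span G m E) G" using m E by (rule conj_span_subgroup)
  fix g h assume "g \<in> carrier G" "h \<in> conj_span G m E"
  then have "g \<in> generate G T" using gen by simp
  then have "\<forall>h \<in> conj_span G m E. conjugate G g h \<in> conj_span G m E"
  proof (induction rule: generate.induct)
    case one
    then show ?case using subgroup.mem_carrier[OF sub] by simp
  next
    case (eng g1 g2)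
    then have "g1 \<in> carrier G" "g2 \<in> carrier G" using gen by auto
    then show ?case
      using eng.IH subgroup.mem_carrier[OF sub] by (metis conjugate_conjugate)
  qed (use inv in \<open>auto simp: conj_invariant_def\<close>)
  then show "g \<otimes> h \<otimes> inv g \<in> conj_span G m E"
    using \<open>h \<in> conj_span G m E\<close> unfolding conjugate_def by blast
qed

section \<open>Polycyclic extensions by finitely generated abelian groups\<close>

text \<open>
  Elements that commute modulo \<open>K\<close> with a fixed element form a subgroup; this is used once in
  each argument of the commutator.
\<close>
lemma commutator_generate:
  assumes K: "K \<lhd> G" and S: "S \<subseteq> carrier G"
    and comm: "\<And>s t. \<lbrakk>s \<in> S; t \<in> S\<rbrakk> \<Longrightarrow> commutator G s t \<in> K"
    and xy: "x \<in> generate G S" "y \<in> generate G S"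
  shows "commutator G x y \<in> K"
proof -
  have sub: "subgroup K G" and conj: "\<And>g h. \<lbrakk>g \<in> carrier G; h \<in> K\<rbrakk> \<Longrightarrow> conjugate G g h \<in> K"
    using normal_invE[OF K] by (simp_all add: conjugate_def)
  have flip: "commutator G b a = inv (commutator G a b)" if "a \<in> carrier G" "b \<in> carrier G" for a b
    using that by (simp add: commutator_def inv_mult_group m_assoc)
  have right: "commutator G a b \<in> K"
    if a: "a \<in> carrier G" and gen: "\<And>t. t \<in> S \<Longrightarrow> commutator G a t \<in> K"
      and b: "b \<in> generate G S" for a b
    using b
  proof (induction rule: generate.induct)
    case one
    then show ?case using a subgroup.one_closed[OF sub] by (simp add: commutator_def)
  next
    case (incl h)
    then show ?case by (rule gen)
  next
    case (inv h)
    then have "h \<in> carrier G" using S by auto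
    then have "commutator G a (inv h) = conjugate G (inv h) (inv (commutator G a h))"
      using a by (simp add: commutator_def conjugate_def inv_mult_group m_assoc inv_cancel)
    then show ?case
      using \<open>h \<in> carrier G\<close> conj gen[OF inv] subgroup.m_inv_closed[OF sub] by simp
  next
    case (eng h k)
    then have hk: "h \<in> carrier G" "k \<in> carrier G" using S generate_in_carrier by auto
    then have "commutator G a (h \<otimes> k) = commutator G a h \<otimes> conjugate G h (commutator G a k)"
      using a by (simp add: commutator_def conjugate_def inv_mult_group m_assoc inv_cancel)
    then show ?case using eng.IH hk conj subgroup.m_closed[OF sub] by simp
  qed
  have "commutator G t x \<in> K" if "t \<in> S" for t
    using right[of t x] that comm xy(1) S by blast
  then have "commutator G x t \<in> K" if "t \<in> S" for t
    using that flip[of t x] S xy(1) generate_in_carrier subgroup.m_inv_closed[OF sub] by auto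
  then show ?thesis using right[of x y] xy S generate_in_carrier by blast
qed

text \<open>
  All commutators of \<open>C\<close> lie in \<open>L\<close>, so \<open>L\<close> is normal in every subgroup between \<open>L\<close> and \<open>C\<close>, and the
  quotient by \<open>L\<close> of the subgroup generated by \<open>L\<close> and \<open>s\<close> is generated by the coset of \<open>s\<close>.
\<close>
lemma polycyclic_seq_adjoin:
  assumes L: "polycyclic_seq G L" "subgroup L G" and C: "subgroup C G" "L \<subseteq> C" "s \<in> C"
    and comm: "\<And>x y. \<lbrakk>x \<in> C; y \<in> C\<rbrakk> \<Longrightarrow> commutator G x y \<in> L"
  shows "polycyclic_seq G (generate G (insert s L))"
proof -
  define H where "H = generate G (insert s L)"
  have sL: "insert s L \<subseteq> carrier G" using C subgroup.subset by blast
  have H: "subgroup H G" unfolding H_def by (rule generate_is_subgroup[OF sL])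
  have HC: "H \<subseteq> C" unfolding H_def using C by (intro generate_subgroup_incl) auto
  have LH: "insert s L \<subseteq> H" unfolding H_def by (auto intro: generate.incl)
  let ?H = "G\<lparr>carrier := H\<rparr>"
  interpret H: group ?H using subgroup_imp_group[OF H] .
  have norm: "L \<lhd> ?H"
  proof (rule H.normal_invI)
    show "subgroup L ?H" using subgroup_incl[OF L(2) H] LH by simp
    fix x h assume "x \<in> carrier ?H" "h \<in> L"
    then have x: "x \<in> H" "x \<in> C" "x \<in> carrier G" and h: "h \<in> L" "h \<in> C" "h \<in> carrier G"
      using HC C subgroup.subset[OF C(1)] by auto
    have "x \<otimes> h \<otimes> inv x = commutator G x h \<otimes> h"
      using x h by (simp add: commutator_def inv_mult_group m_assoc)
    also have "\<dots> \<in> L" using comm x h subgroup.m_closed[OF L(2)] by blast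
    finally show "x \<otimes>\<^bsub>?H\<^esub> h \<otimes>\<^bsub>?H\<^esub> inv\<^bsub>?H\<^esub> x \<in> L" using x H by (simp add: m_inv_consistent)
  qed
  interpret L: normal L ?H by (rule norm)
  interpret Q: group "?H Mod L" by (rule L.factorgroup_is_group)
  let ?q = "\<lambda>h. L #>\<^bsub>?H\<^esub> h"
  interpret q: group_hom ?H "?H Mod L" ?q
    by unfold_locales (rule L.r_coset_hom_Mod)
  have qs: "?q s \<in> carrier (?H Mod L)" using LH by (intro q.hom_closed) auto
  have "?q ` insert s L \<subseteq> generate (?H Mod L) {?q s}"
  proof clarify
    fix h assume "h \<in> insert s L"
    show "?q h \<in> generate (?H Mod L) {?q s}"
    proof (cases "h = s")
      case True
      then show ?thesis by (simp add: generate.incl)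
    next
      case False
      then have "?q h = L" using \<open>h \<in> insert s L\<close> LH L.subgroup_axioms
        by (intro H.coset_join2) auto
      then show ?thesis using generate.one[of "?H Mod L" "{?q s}"] by simp
    qed
  qed
  then have "generate (?H Mod L) (?q ` insert s L) \<subseteq> generate (?H Mod L) {?q s}"
    using qs by (intro Q.generate_subgroup_incl Q.generate_is_subgroup) auto
  moreover have "generate (?H Mod L) (?q ` insert s L) = ?q ` generate ?H (insert s L)"
    using LH by (intro q.generate_img) auto
  moreover have "generate ?H (insert s L) = H"
    using generate_consistent[OF LH H] by (simp add: H_def)
  moreover have "carrier (?H Mod L) = ?q ` H" by (simp add: carrier_FactGroup)
  ultimately have "carrier (?H Mod L) \<subseteq> range (\<lambda>k::int. ?q s [^]\<^bsub>?H Mod L\<^esub> k)"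
    using Q.generate_pow[OF qs] by auto
  then have "carrier (?H Mod L) = range (\<lambda>k::int. ?q s [^]\<^bsub>?H Mod L\<^esub> k)"
    using Q.int_pow_closed[OF qs] by auto
  then have "cyclic_group (?H Mod L)" using Q.cyclic_group qs by blast
  then show ?thesis using polycyclic_seq.extension[OF L(1) norm H] unfolding H_def by simp
qed

lemma polycyclic_seq_generate:
  assumes K: "polycyclic_seq G K" "subgroup K G" and C: "subgroup C G" "K \<subseteq> C"
    and comm: "\<And>x y. \<lbrakk>x \<in> C; y \<in> C\<rbrakk> \<Longrightarrow> commutator G x y \<in> K"
    and F: "finite F" "F \<subseteq> C"
  shows "polycyclic_seq G (generate G (K \<union> F))"
  using F
proof (induction F rule: finite_induct)
  case empty
  then show ?case using K generateI[OF K(2), of K] by simp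
next
  case (insert s F)
  define L where "L = generate G (K \<union> F)"
  have car: "K \<union> insert s F \<subseteq> carrier G" using insert.prems C subgroup.subset by blast
  have L: "subgroup L G" unfolding L_def using car by (intro generate_is_subgroup) auto
  have KL: "K \<union> F \<subseteq> L" unfolding L_def by (auto intro: generate.incl)
  have LC: "L \<subseteq> C" unfolding L_def using insert.prems C by (intro generate_subgroup_incl) auto
  have "polycyclic_seq G (generate G (insert s L))"
    by (rule polycyclic_seq_adjoin[OF _ L C(1) LC])
       (use insert comm KL in \<open>auto simp: L_def\<close>)
  moreover have "generate G (insert s L) = generate G (K \<union> insert s F)"
  proof
    have "L \<subseteq> generate G (K \<union> insert s F)" unfolding L_def by (rule mono_generate) auto
    then show "generate G (insert s L) \<subseteq> generate G (K \<union> insert s F)"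
      using car by (intro generate_subgroup_incl generate_is_subgroup) (auto intro: generate.incl)
    show "generate G (K \<union> insert s F) \<subseteq> generate G (insert s L)"
      using KL by (intro mono_generate) auto
  qed
  ultimately show ?case by simp
qed

section \<open>Words of length three\<close>

text \<open>
  The series climbs from \<open>\<one>\<close> to the finitely generated normal
  subgroup \<open>K\<close> inside the abelian group \<open>N\<close>, and from \<open>K\<close> to the whole group inside the abelian
  quotient by \<open>K\<close>.
\<close>
lemma polycyclic_if_short_pairs_dependent:
  assumes met: "metabelian G"
    and S: "finite S" "S \<subseteq> carrier G" "generate G S = carrier G" "\<one> \<in> S"
    and dep: "\<And>x y z. \<lbrakk>x \<in> S; y \<in> S; z \<in> S\<rbrakk>
      \<Longrightarrow> \<not> positively_independent G (x \<otimes> y \<otimes> z) (y \<otimes> x \<otimes> z)"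
  shows "polycyclic G"
proof -
  obtain N where N: "N \<lhd> G" "comm_group (G\<lparr>carrier := N\<rparr>)" "comm_group (G Mod N)"
    using met unfolding metabelian_def by blast
  interpret N: normal N G by (rule N(1))
  have sub: "subgroup N G" by (rule N.subgroup_axioms)
  have conjN: "conjugate G g h \<in> N" if "g \<in> carrier G" "h \<in> N" for g h
    using normal_invE(2)[OF N(1)] that by (simp add: conjugate_def)
  have abel: "x \<otimes> y = y \<otimes> x" if "x \<in> N" "y \<in> N" for x y
    using comm_groupE(4)[OF N(2)] that by simp
  have commN: "commutator G x y \<in> N" if xy: "x \<in> carrier G" "y \<in> carrier G" for x y
  proof -
    have "N #> (x \<otimes> y) = N #> (y \<otimes> x)"
      using comm_groupE(4)[OF N(3), of "N #> x" "N #> y"] xy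
      by (auto simp: carrier_FactGroup N.rcos_sum)
    then have "x \<otimes> y \<in> N #> (y \<otimes> x)" using rcos_self[OF _ sub] xy by (metis m_closed)
    then obtain n where "n \<in> N" "x \<otimes> y = n \<otimes> (y \<otimes> x)" unfolding r_coset_def by auto
    then show ?thesis using xy unfolding commutator_def by (simp add: m_assoc)
  qed
  have swap: "conjugate G (g \<otimes> h) m = conjugate G (h \<otimes> g) m"
    if gh: "g \<in> carrier G" "h \<in> carrier G" and m: "m \<in> N" for g h m
  proof -
    have mc: "m \<in> carrier G" using m by simp
    \<comment> \<open>\<open>gh = c hg\<close> with \<open>c \<in> N\<close>, and conjugation by \<open>c\<close> is trivial on \<open>N\<close>.\<close>
    define c k where "c = commutator G g h" and "k = conjugate G (h \<otimes> g) m"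
    have ck: "c \<in> N" "k \<in> N" unfolding c_def k_def using gh m commN conjN by auto
    have "conjugate G (g \<otimes> h) m = conjugate G c k"
      using gh mc commutator_mult[OF gh] by (simp add: c_def k_def conjugate_conjugate)
    also have "\<dots> = k" using abel[OF ck] ck by (simp add: conjugate_def m_assoc)
    finally show ?thesis unfolding k_def .
  qed
  have "\<exists>E. finite E \<and> E \<subseteq> carrier G \<and> \<one> \<in> E \<and> conj_span G (commutator G x y) E \<lhd> G"
    if xy: "x \<in> S" "y \<in> S" for x y
  proof -
    define m where "m = commutator G x y"
    define T where "T = (\<lambda>z. y \<otimes> x \<otimes> z) ` S"
    have xyc: "x \<in> carrier G" "y \<in> carrier G" using xy S by auto
    have m: "m \<in> N" "m \<in> carrier G" unfolding m_def using xyc commN by auto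
    have T: "finite T" "T \<subseteq> carrier G" unfolding T_def using S xyc by auto
    have single: "\<exists>E. finite E \<and> E \<subseteq> carrier G \<and> \<one> \<in> E \<and> conj_invariant G m E t"
      if "t \<in> T" for t
    proof -
      from that obtain z where z: "z \<in> S" "t = y \<otimes> x \<otimes> z" unfolding T_def by blast
      then have "m \<otimes> t = x \<otimes> y \<otimes> z"
        using xyc S commutator_mult[OF xyc] unfolding m_def
        by (metis commutator_closed m_assoc m_closed subsetD)
      then have "\<not> positively_independent G (m \<otimes> t) t" using dep xy z by simp
      moreover have "t \<in> carrier G" using that T by auto
      ultimately show ?thesis using dependent_pair_finite_span[OF m(2)] by metis
    qed
    obtain E where E: "finite E" "E \<subseteq> carrier G" "\<one> \<in> E" "\<forall>t\<in>T. conj_invariant G m E t"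
      using conj_invariant_combine[OF m(2) swap[OF _ _ m(1)] T single] by metis
    have "S \<subseteq> generate G T"
    proof
      fix z assume z: "z \<in> S"
      have "y \<otimes> x \<otimes> \<one> \<in> T" "y \<otimes> x \<otimes> z \<in> T" unfolding T_def using z S(4) by auto
      then have "inv (y \<otimes> x \<otimes> \<one>) \<otimes> (y \<otimes> x \<otimes> z) \<in> generate G T"
        by (intro generate.eng generate.inv generate.incl)
      moreover have "inv (y \<otimes> x \<otimes> \<one>) \<otimes> (y \<otimes> x \<otimes> z) = z"
        using z S(2) xyc by (simp add: inv_cancel subset_iff)
      ultimately show "z \<in> generate G T" by simp
    qed
    then have "carrier G \<subseteq> generate G T"
      using generate_subgroup_incl[OF _ generate_is_subgroup[OF T(2)]] S(3) by blast
    then have "generate G T = carrier G" using generate_incl[OF T(2)] by blast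
    then show ?thesis
      using conj_span_normal[OF m(2) E(2) T(2) _ E(4)] E unfolding m_def by blast
  qed
  then obtain E where E: "\<And>x y. \<lbrakk>x \<in> S; y \<in> S\<rbrakk> \<Longrightarrow> finite (E x y) \<and> E x y \<subseteq> carrier G \<and>
      \<one> \<in> E x y \<and> conj_span G (commutator G x y) (E x y) \<lhd> G"
    by metis
  define B where "B = (\<Union>x\<in>S. \<Union>y\<in>S. (\<lambda>e. conjugate G e (commutator G x y)) ` E x y)"
  define K where "K = generate G ({\<one>} \<union> B)"
  have finB: "finite B" unfolding B_def using S E by blast
  have BN: "B \<subseteq> N"
  proof
    fix b assume "b \<in> B"
    then obtain x y e where "x \<in> S" "y \<in> S" "e \<in> E x y" "b = conjugate G e (commutator G x y)"
      unfolding B_def by blast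
    then show "b \<in> N" using E[of x y] S(2) by (auto intro!: conjN commN)
  qed
  then have Bc: "{\<one>} \<union> B \<subseteq> carrier G" using N.subset by auto
  have Ksub: "subgroup K G" unfolding K_def by (rule generate_is_subgroup[OF Bc])
  have span: "conj_span G (commutator G x y) (E x y) \<subseteq> K" if "x \<in> S" "y \<in> S" for x y
    unfolding conj_span_def K_def by (rule mono_generate) (use that in \<open>auto simp: B_def\<close>)
  have Kn: "K \<lhd> G"
  proof (rule normal_invI[OF Ksub])
    fix g h assume g: "g \<in> carrier G" and h: "h \<in> K"
    have "conjugate G g b \<in> K" if b: "b \<in> {\<one>} \<union> B" for b
    proof (cases "b = \<one>")
      case True
      then show ?thesis using g subgroup.one_closed[OF Ksub] by simp
    next
      case False
      then obtain x y e where x: "x \<in> S" "y \<in> S" "e \<in> E x y" "b = conjugate G e (commutator G x y)"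
        using b unfolding B_def by blast
      have "b \<in> conj_span G (commutator G x y) (E x y)" unfolding x(4) using x(3) by (rule conj_span_incl)
      then have "conjugate G g b \<in> conj_span G (commutator G x y) (E x y)"
        using E[OF x(1,2)] g normal_invE(2) unfolding conjugate_def by blast
      then show ?thesis using span[OF x(1,2)] by blast
    qed
    then show "g \<otimes> h \<otimes> inv g \<in> K"
      using conjugate_generate[OF Ksub g Bc] h unfolding K_def conjugate_def by blast
  qed
  have "polycyclic_seq G K"
    unfolding K_def
  proof (rule polycyclic_seq_generate[OF polycyclic_seq.unity triv_subgroup sub _ _ finB BN])
    show "{\<one>} \<subseteq> N" by simp
    fix x y assume "x \<in> N" "y \<in> N"
    then show "commutator G x y \<in> {\<one>}" using abel[of x y] by (simp add: commutator_def)
  qed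
  moreover have "commutator G x y \<in> K" if "x \<in> carrier G" "y \<in> carrier G" for x y
  proof (rule commutator_generate[OF Kn S(2)])
    fix s t assume st: "s \<in> S" "t \<in> S"
    have "conjugate G \<one> (commutator G s t) \<in> conj_span G (commutator G s t) (E s t)"
      using E[OF st] by (intro conj_span_incl) auto
    then show "commutator G s t \<in> K" using span[OF st] st S(2) by (auto simp: subset_iff)
  qed (use that S(3) in auto)
  ultimately have "polycyclic_seq G (generate G (K \<union> S))"
    using Ksub subgroup_self S subgroup.subset[OF Ksub]
    by (intro polycyclic_seq_generate[where C = "carrier G"]) auto
  moreover have "generate G (K \<union> S) = carrier G"
    using mono_generate[of S "K \<union> S"] generate_incl[of "K \<union> S"] S subgroup.subset[OF Ksub] by auto
  ultimately show ?thesis unfolding polycyclic_def using is_group by simp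
qed

end

theorem proposition7p1:
  fixes \<Gamma> :: "('a, 'b) monoid_scheme"
  assumes "group \<Gamma>"
    and "finitely_generated_group \<Gamma>"
    and "metabelian \<Gamma>"
    and "\<not> polycyclic \<Gamma>"
  shows "d_plus_group \<Gamma> \<le> 3"
proof -
  interpret group \<Gamma> by fact
  have "d_plus \<Gamma> S \<le> 3" if "S \<in> sym_generating_sets \<Gamma>" for S
  proof -
    have S: "finite S" "S \<subseteq> carrier \<Gamma>" "generate \<Gamma> S = carrier \<Gamma>" "\<one>\<^bsub>\<Gamma>\<^esub> \<in> S"
      using that unfolding sym_generating_sets_def by auto
    obtain x y z where xyz: "x \<in> S" "y \<in> S" "z \<in> S"
      and indep: "positively_independent \<Gamma> (x \<otimes>\<^bsub>\<Gamma>\<^esub> y \<otimes>\<^bsub>\<Gamma>\<^esub> z) (y \<otimes>\<^bsub>\<Gamma>\<^esub> x \<otimes>\<^bsub>\<Gamma>\<^esub> z)"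
      using polycyclic_if_short_pairs_dependent[OF assms(3) S] assms(4) by blast
    have short: "a \<otimes>\<^bsub>\<Gamma>\<^esub> b \<otimes>\<^bsub>\<Gamma>\<^esub> c \<in> set_power \<Gamma> S 3" if "a \<in> S" "b \<in> S" "c \<in> S" for a b c
    proof -
      have "word_prod \<Gamma> [a, b, c] = a \<otimes>\<^bsub>\<Gamma>\<^esub> b \<otimes>\<^bsub>\<Gamma>\<^esub> c"
        using that S(2) by (simp add: subset_iff m_assoc)
      then show ?thesis unfolding set_power_def using that
        by (intro CollectI exI[of _ "[a, b, c]"]) auto
    qed
    have "d_plus \<Gamma> S \<le> enat 3"
      unfolding d_plus_def using short[OF xyz] short[OF xyz(2,1,3)] indep
      by (intro Inf_lower) blast
    then show ?thesis by (simp add: numeral_eq_enat)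
  qed
  then show ?thesis unfolding d_plus_group_def by (rule SUP_least)
qed

end
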